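(* We have $A=\varphi A_+-A_-$. Moreover \[ qA_-A^*-A^*A_-=I,\qquad qA^*A_+-A_+A^*=I,\qquad qA_+A_--A_-A_+=\frac{q^N I}{q-1}. \]
   Context: Let $q$ be a prime power, $GF(q)$ the field with $q$ elements, $N\ge 1$ an integer, and $\mathbf V$ an $N$-dimensional vector space over $GF(q)$. Let $X$ be the set of all subspaces of $\mathbf V$, ordered by inclusion (the projective geometry $L_N(q)$). For $y,z\in X$, $y$ covers $z$ means $z\subseteq y$ and $\dim y-\dim z=1$. ${\rm Mat}_X(\mathbb C)$ is the algebra of complex matrices with rows and columns indexed by $X$, with identity $I$. $A^*\in{\rm Mat}_X(\mathbb C)$ is the diagonal matrix with $(y,y)$-entry $q^{-\dim y}$. $R,L\in{\rm Mat}_X(\mathbb C)$: $R_{y,z}=1$ if $y$ covers $z$ and $0$ otherwise; $L_{y,z}=1$ if $z$ covers $y$ and $0$ otherwise. Fix a real number $\varphi>0$. The matrix $A\in{\rm Mat}_X(\mathbb C)$ has $(y,z)$-entry $1$ if $y$ covers $z$; $\varphi q^{\dim y}$ if $z$ covers $y$; $\frac{\varphi-1}{q-1}q^{\dim y}$ if $y=z$; and $0$ otherwise. Define \[ A_+=\frac{(A^* )^{-1}}{q-1}+\varphi^{-1}R,\qquad A_-=\frac{(A^* )^{-1}}{q-1}-\varphi(A^* )^{-1}L . \] *)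

theory Defs
  imports "HOL-Analysis.Analysis" "HOL-Number_Theory.Prime_Powers"
begin

text \<open>
  The index set \<open>X\<close> of all subspaces is represented by a finite index type \<open>'x\<close> together with a
  bijection \<open>S :: 'x \<Rightarrow> 'v set\<close> onto the set of all subspaces of the ambient space, so that
  \<open>Mat\<^sub>X(\<complex>)\<close> is the library's type \<open>complex ^ 'x ^ 'x\<close>, with product \<open>**\<close>, identity \<open>mat 1\<close> and
  inverse \<open>matrix_inv\<close>. The \<open>(y, z)\<close>-entry of \<open>M\<close> is \<open>M $ y $ z\<close>. The field size \<open>q\<close> is a
  parameter, tied to the field in the theorem.
\<close>

definition covers :: "('k::field \<Rightarrow> 'v::ab_group_add \<Rightarrow> 'v) \<Rightarrow> 'v set \<Rightarrow> 'v set \<Rightarrow> bool" where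
  "covers scl U W \<longleftrightarrow> W \<subseteq> U \<and> vector_space.dim scl U = vector_space.dim scl W + 1"

definition A_star_mat ::
  "('k::field \<Rightarrow> 'v::ab_group_add \<Rightarrow> 'v) \<Rightarrow> ('x::finite \<Rightarrow> 'v set) \<Rightarrow> nat \<Rightarrow> complex ^ 'x ^ 'x" where
  "A_star_mat scl S q =
     (\<chi> y z. if y = z then of_nat q powi (- int (vector_space.dim scl (S y))) else 0)"

definition R_mat ::
  "('k::field \<Rightarrow> 'v::ab_group_add \<Rightarrow> 'v) \<Rightarrow> ('x::finite \<Rightarrow> 'v set) \<Rightarrow> complex ^ 'x ^ 'x" where
  "R_mat scl S = (\<chi> y z. if covers scl (S y) (S z) then 1 else 0)"

definition L_mat ::
  "('k::field \<Rightarrow> 'v::ab_group_add \<Rightarrow> 'v) \<Rightarrow> ('x::finite \<Rightarrow> 'v set) \<Rightarrow> complex ^ 'x ^ 'x" where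
  "L_mat scl S = (\<chi> y z. if covers scl (S z) (S y) then 1 else 0)"

definition A_mat ::
  "('k::field \<Rightarrow> 'v::ab_group_add \<Rightarrow> 'v) \<Rightarrow> ('x::finite \<Rightarrow> 'v set) \<Rightarrow> nat \<Rightarrow> real
    \<Rightarrow> complex ^ 'x ^ 'x" where
  "A_mat scl S q \<phi> =
     (\<chi> y z. if covers scl (S y) (S z) then 1
       else if covers scl (S z) (S y)
         then of_real \<phi> * of_nat q ^ vector_space.dim scl (S y)
       else if y = z
         then (of_real \<phi> - 1) / (of_nat q - 1) * of_nat q ^ vector_space.dim scl (S y)
       else 0)"

definition A_plus_mat ::
  "('k::field \<Rightarrow> 'v::ab_group_add \<Rightarrow> 'v) \<Rightarrow> ('x::finite \<Rightarrow> 'v set) \<Rightarrow> nat \<Rightarrow> real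
    \<Rightarrow> complex ^ 'x ^ 'x" where
  "A_plus_mat scl S q \<phi> =
     (1 / (real q - 1)) *\<^sub>R matrix_inv (A_star_mat scl S q) + inverse \<phi> *\<^sub>R R_mat scl S"

definition A_minus_mat ::
  "('k::field \<Rightarrow> 'v::ab_group_add \<Rightarrow> 'v) \<Rightarrow> ('x::finite \<Rightarrow> 'v set) \<Rightarrow> nat \<Rightarrow> real
    \<Rightarrow> complex ^ 'x ^ 'x" where
  "A_minus_mat scl S q \<phi> =
     (1 / (real q - 1)) *\<^sub>R matrix_inv (A_star_mat scl S q)
     - \<phi> *\<^sub>R (matrix_inv (A_star_mat scl S q) ** L_mat scl S)"

end

theory Submission
  imports Defs
begin

text \<open>
  Write \<open>K\<close> for the inverse of \<open>A\<^sup>*\<close>. Since \<open>R\<close> raises and \<open>L\<close> lowers dimension by one, \<open>K\<close> commutes with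
  them up to a factor \<open>q\<close>, which settles everything except the last relation. There the terms linear
  in \<open>R\<close> or \<open>L\<close> cancel for the same reason, and what remains is
  \<open>(q - 1) (L R - R L) = q\<^sup>N A\<^sup>* - K\<close>. Off the diagonal, \<open>y + z\<close> is a common cover of \<open>y \<noteq> z\<close> iff
  \<open>y \<inter> z\<close> is covered by both. On the diagonal, a subspace of dimension \<open>d\<close> has
  \<open>(q ^ (N - d) - 1) / (q - 1)\<close> covers and \<open>(q ^ d - 1) / (q - 1)\<close> hyperplanes.
\<close>

section \<open>Counting subspaces over a finite field\<close>

lemma geometric_sum_nat:
  assumes "m > 0"
  shows "(m - 1) * (\<Sum>i<n. m ^ i) = m ^ n - (1::nat)"
proof -
  obtain k where k: "m = Suc k"
    using assms gr0_implies_Suc by blast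
  have "Suc (k * (\<Sum>i<n. Suc k ^ i)) = Suc k ^ n"
    by (induction n) (simp_all add: algebra_simps)
  with k show ?thesis by (metis diff_Suc_1)
qed

section \<open>Cardinalities of subspaces\<close>

locale finite_field_space = finite_dimensional_vector_space scale Basis
  for scale :: "'k::{field,finite} \<Rightarrow> 'v::ab_group_add \<Rightarrow> 'v"
    and Basis :: "'v set"
begin

text \<open>Each vector of the span is \<open>scale k v + u\<close> for exactly one pair
  \<open>(k, u)\<close> with \<open>u \<in> U\<close>: two different scalars would put a nonzero
  multiple of \<open>v\<close>, hence \<open>v\<close> itself, into \<open>U\<close>.\<close>

lemma card_span_insert:
  assumes "subspace U" "v \<notin> U"
  shows "card (span (insert v U)) = CARD('k) * card U"
proof -
  have "inj_on (\<lambda>(k, u). scale k v + u) (UNIV \<times> U)"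
  proof (rule inj_onI, clarsimp)
    fix k l x y
    assume *: "x \<in> U" "y \<in> U" "scale k v + x = scale l v + y"
    then have "scale (k - l) v = y - x"
      by (simp add: algebra_simps)
    with * assms(1) have "scale (k - l) v \<in> U"
      by (simp add: subspace_diff)
    then have "k - l = 0"
      using assms subspace_scale[of U "scale (k - l) v" "inverse (k - l)"]
      by (metis left_inverse scale_one scale_scale)
    then have "k = l"
      by simp
    with * show "k = l \<and> x = y"
      by simp
  qed
  moreover have "(\<lambda>(k, u). scale k v + u) ` (UNIV \<times> U) = span (insert v U)"
  proof -
    have "x \<in> (\<lambda>(k, u). scale k v + u) ` (UNIV \<times> U)" if "x - scale k v \<in> U" for x k
      using that by (intro image_eqI[of _ _ "(k, x - scale k v)"]) auto
    moreover have "\<exists>l. scale k v + u - scale l v \<in> U" if "u \<in> U" for k u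
      using that by (intro exI[of _ k]) simp
    moreover have "span (insert v U) = {x. \<exists>k. x - scale k v \<in> U}"
      using assms(1) by (metis span_eq_iff span_insert)
    ultimately show ?thesis
      by auto
  qed
  ultimately show ?thesis
    using card_image[of "\<lambda>(k, u). scale k v + u" "UNIV \<times> U"]
    by (simp add: card_cartesian_product)
qed

text \<open>Induction over a basis: by \<open>card_span_insert\<close> each further independent
  vector multiplies the size by the order of the field.\<close>

lemma card_subspace:
  assumes "subspace U"
  shows "card U = CARD('k) ^ dim U"
proof -
  have *: "card (span B) = CARD('k) ^ card B" if "finite B" "independent B" for B
    using that
  proof (induction B rule: finite_induct)
    case (insert b B)
    then have "independent B" "b \<notin> span B"
      by (simp_all add: independent_insert)
    moreover have "span (insert b (span B)) = span (insert b B)"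
      by (simp only: span_insert span_span)
    ultimately show ?case
      using insert.IH insert.hyps card_span_insert[of "span B" b] by simp
  qed simp
  obtain B where "finite B" "independent B" "span B = U" "card B = dim U"
    using basis_subspace_exists assms by metis
  with * show ?thesis by metis
qed

lemma finite_subspace: "subspace U \<Longrightarrow> finite U"
  using card_subspace[of U] card_ge_0_finite[of U] by simp

lemma finite_set_of_subsets [simp]: "finite (A :: 'v set set)"
proof -
  have "finite (UNIV :: 'v set)"
    by (simp add: finite_subspace)
  then have "finite (Pow (UNIV :: 'v set))"
    by (simp only: finite_Pow_iff)
  then show ?thesis
    by (rule finite_subset[rotated]) simp
qed

section \<open>Covers of a subspace\<close>

lemma covers_span_insert:
  assumes "subspace G" "v \<notin> G"
  shows "covers scale (span (insert v G)) G"
proof -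
  have "v \<notin> span G"
    using assms by (metis span_eq_iff)
  then show ?thesis
    by (auto simp: covers_def dim_insert intro: span_base)
qed

text \<open>A cover of \<open>G\<close> is determined by any one of its vectors outside
  \<open>G\<close>, so distinct covers meet only in \<open>G\<close>.\<close>

lemma covers_eq_span_insert:
  assumes "subspace W" "subspace G" "covers scale W G" "v \<in> W" "v \<notin> G"
  shows "span (insert v G) = W"
proof (rule subspace_dim_equal)
  show "span (insert v G) \<subseteq> W"
    using assms by (intro span_minimal) (auto simp: covers_def)
  show "dim W \<le> dim (span (insert v G))"
    using covers_span_insert[of G v] assms by (simp add: covers_def)
qed (use assms in auto)

text \<open>The sets \<open>W - G\<close>, for the covers \<open>W\<close> of \<open>G\<close>
  inside \<open>U\<close>, partition \<open>U - G\<close>, and all have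
  \<open>q ^ dim G * (q - 1)\<close> elements. The bound \<open>U\<close> is arbitrary because the
  hyperplane count needs it for \<open>G\<close> of codimension 2 in \<open>U\<close>; the geometric
  sum avoids division of naturals.\<close>

lemma card_covers_within:
  assumes "subspace U" "subspace G" "G \<subseteq> U"
  shows "card {W. subspace W \<and> covers scale W G \<and> W \<subseteq> U} = (\<Sum>i<dim U - dim G. CARD('k) ^ i)"
proof -
  let ?C = "{W. subspace W \<and> covers scale W G \<and> W \<subseteq> U}" and ?q = "CARD('k)"
  have q: "?q > 1"
    using card_mono[of UNIV "{0, 1 :: 'k}"] by simp
  have le: "dim G \<le> dim U"
    using assms(3) by (rule dim_subset)
  have "U - G = (\<Union>W\<in>?C. W - G)"
  proof (intro equalityI subsetI)
    fix v assume v: "v \<in> U - G"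
    then have "span (insert v G) \<in> ?C"
      using assms covers_span_insert[of G v] span_minimal[of "insert v G" U] by auto
    with v show "v \<in> (\<Union>W\<in>?C. W - G)"
      by (blast intro: span_base)
  qed auto
  moreover have "card (\<Union>W\<in>?C. W - G) = (\<Sum>W\<in>?C. card (W - G))"
  proof (rule card_UN_disjoint)
    show "\<forall>W\<in>?C. \<forall>W'\<in>?C. W \<noteq> W' \<longrightarrow> (W - G) \<inter> (W' - G) = {}"
    proof (intro ballI impI)
      fix W W' assume W: "W \<in> ?C" "W' \<in> ?C" "W \<noteq> W'"
      then have "W = W'" if "v \<in> W - G" "v \<in> W' - G" for v
        using that covers_eq_span_insert[of _ G v] assms(2) by (metis (mono_tags, lifting) DiffE mem_Collect_eq)
      with W(3) show "(W - G) \<inter> (W' - G) = {}"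
        by blast
    qed
  qed (auto simp: finite_subspace)
  moreover have "(\<Sum>W\<in>?C. card (W - G)) = (\<Sum>W\<in>?C. ?q ^ dim G * (?q - 1))"
  proof (rule sum.cong[OF refl])
    show "card (W - G) = ?q ^ dim G * (?q - 1)" if "W \<in> ?C" for W
      using that assms finite_subspace[of G]
      by (simp add: card_Diff_subset covers_def card_subspace algebra_simps)
  qed
  moreover have "card (U - G) = ?q ^ dim G * (?q ^ (dim U - dim G) - 1)"
    using assms le finite_subspace[of G]
    by (simp add: card_Diff_subset card_subspace diff_mult_distrib2 flip: power_add)
  ultimately have "card ?C * (?q ^ dim G * (?q - 1)) = ?q ^ dim G * (?q ^ (dim U - dim G) - 1)"
    by (simp only: sum_constant of_nat_id)
  also have "\<dots> = ?q ^ dim G * ((?q - 1) * (\<Sum>i<dim U - dim G. ?q ^ i))"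
    by (simp only: geometric_sum_nat zero_less_card_finite)
  also have "\<dots> = (\<Sum>i<dim U - dim G. ?q ^ i) * (?q ^ dim G * (?q - 1))"
    by (simp only: mult_ac)
  finally have "card ?C * (?q ^ dim G * (?q - 1)) = (\<Sum>i<dim U - dim G. ?q ^ i) * (?q ^ dim G * (?q - 1))" .
  then show ?thesis
    using q by simp
qed

section \<open>The modular law and common neighbours of two subspaces\<close>

lemma dim_span_Un_Int:
  assumes "subspace U" "subspace W"
  shows "dim (span (U \<union> W)) + dim (U \<inter> W) = dim U + dim W"
proof -
  have "span (U \<union> W) = {x + y |x y. x \<in> U \<and> y \<in> W}"
    using assms by (simp add: span_Un span_eq_iff[THEN iffD2])
  then show ?thesis
    using dim_sums_Int[OF assms] by simp
qed

text \<open>Both subspaces have the same dimension \<open>d\<close> and are distinct, so their sum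
  has dimension above \<open>d\<close>. It lies in \<open>T\<close>, of dimension
  \<open>d + 1\<close>, and so equals \<open>T\<close>; the modular law then gives the intersection
  dimension \<open>d - 1\<close>.\<close>

lemma common_cover_eq:
  assumes "subspace U" "subspace W" "subspace T" "U \<noteq> W" "covers scale T U" "covers scale T W"
  shows "T = span (U \<union> W)"
    and "covers scale U (U \<inter> W)" "covers scale W (U \<inter> W)"
proof -
  have sub: "span (U \<union> W) \<subseteq> T"
    using assms by (intro span_minimal) (auto simp: covers_def)
  have dims: "dim U = dim W" "dim T = dim U + 1"
    using assms by (auto simp: covers_def)
  have "\<not> W \<subseteq> U"
    using subspace_dim_equal[of W U] assms dims by auto
  then have "dim U < dim (span (U \<union> W))"
    using assms(1) by (intro dim_psubset) (auto simp: span_eq_iff[THEN iffD2] intro: span_base)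
  then have "dim (span (U \<union> W)) = dim T"
    using dim_subset[OF sub] dims by simp
  then show "T = span (U \<union> W)"
    using sub assms(3) by (metis subspace_dim_equal subspace_span order_refl)
  then show "covers scale U (U \<inter> W)" "covers scale W (U \<inter> W)"
    using dim_span_Un_Int[OF assms(1,2)] dims by (auto simp: covers_def)
qed

text \<open>Dual to \<open>common_cover_eq\<close>, with intersection and sum exchanged.\<close>

lemma common_covered_eq:
  assumes "subspace U" "subspace W" "subspace T" "U \<noteq> W" "covers scale U T" "covers scale W T"
  shows "T = U \<inter> W"
    and "covers scale (span (U \<union> W)) U" "covers scale (span (U \<union> W)) W"
proof -
  have sub: "T \<subseteq> U \<inter> W"
    using assms by (auto simp: covers_def)
  have dims: "dim U = dim W" "dim U = dim T + 1"
    using assms by (auto simp: covers_def)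
  have "\<not> U \<subseteq> W"
    using subspace_dim_equal[of U W] assms dims by auto
  then have "dim (U \<inter> W) < dim U"
    using assms(1,2) by (intro dim_psubset) (auto simp: span_eq_iff[THEN iffD2] subspace_inter)
  then show eq: "T = U \<inter> W"
    using subspace_dim_equal[OF assms(3) _ sub] assms(1,2) dims subspace_inter by auto
  show "covers scale (span (U \<union> W)) U" "covers scale (span (U \<union> W)) W"
    using dim_span_Un_Int[OF assms(1,2)] dims eq by (auto simp: covers_def intro: span_base)
qed

text \<open>Either set has at most one element, and both are inhabited under the same condition.
  This makes \<open>L ** R\<close> and \<open>R ** L\<close> agree off the diagonal.\<close>

lemma card_common_covers:
  assumes "subspace U" "subspace W" "U \<noteq> W"
  shows "card {T. subspace T \<and> covers scale T U \<and> covers scale T W}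
       = card {T. subspace T \<and> covers scale U T \<and> covers scale W T}" (is "card ?A = card ?B")
proof (cases "covers scale U (U \<inter> W) \<and> covers scale W (U \<inter> W)")
  case True
  have "?A = {span (U \<union> W)}"
    using common_cover_eq[OF assms(1,2) _ assms(3)] common_covered_eq(2,3)[OF assms(1,2) _ assms(3)] True
      subspace_inter[OF assms(1,2)] by auto
  moreover have "?B = {U \<inter> W}"
    using common_covered_eq(1)[OF assms(1,2) _ assms(3)] True subspace_inter[OF assms(1,2)] by blast
  ultimately show ?thesis by simp
next
  case False
  then have "?A = {}" "?B = {}"
    using common_cover_eq[OF assms(1,2) _ assms(3)] common_covered_eq(1)[OF assms(1,2) _ assms(3)]
    by blast+
  then show ?thesis by (simp only:)
qed

text \<open>Fix a hyperplane \<open>H0\<close> of \<open>U\<close>. Any other hyperplane meets \<open>H0\<close> in a hyperplane \<open>G\<close> of \<open>H0\<close>, and each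
  such \<open>G\<close> lies below exactly \<open>q\<close> hyperplanes of \<open>U\<close> other than \<open>H0\<close>; so the
  number \<open>h n\<close> of hyperplanes in dimension \<open>n\<close> satisfies \<open>h (Suc n) = 1 + q * h n\<close>.\<close>

lemma card_hyperplanes:
  assumes "subspace U"
  shows "card {H. subspace H \<and> covers scale U H} = (\<Sum>i<dim U. CARD('k) ^ i)"
  using assms
proof (induction "dim U" arbitrary: U)
  case 0
  have "\<not> covers scale U H" for H
    unfolding covers_def using 0(1) by linarith
  then show ?case
    by (simp flip: 0(1) del: dim_eq_0)
next
  case (Suc n)
  let ?q = "CARD('k)"
  obtain H0 where H0: "subspace H0" "H0 \<subseteq> U" "dim H0 = n"
    using choose_subspace_of_subspace[of n U] Suc.hyps(2) Suc.prems
    by (metis le_add2 plus_1_eq_Suc span_eq_iff)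
  let ?G = "{G. subspace G \<and> covers scale H0 G}"
  define F where "F G = {W. subspace W \<and> covers scale W G \<and> W \<subseteq> U} - {H0}" for G
  have H0U: "covers scale U H0"
    using H0 Suc.hyps(2) by (simp add: covers_def)
  have eq: "{H. subspace H \<and> covers scale U H} = insert H0 (\<Union>G\<in>?G. F G)"
  proof (intro equalityI subsetI)
    fix H assume H: "H \<in> {H. subspace H \<and> covers scale U H}"
    show "H \<in> insert H0 (\<Union>G\<in>?G. F G)"
    proof (cases "H = H0")
      case False
      then have "covers scale H (H \<inter> H0)" "covers scale H0 (H \<inter> H0)"
        using common_cover_eq(2,3)[of H H0 U] H H0(1) H0U Suc.prems by auto
      with False H H0(1) show ?thesis
        by (auto simp: F_def covers_def intro!: exI[of _ "H \<inter> H0"] subspace_inter)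
    qed simp
  next
    fix H assume "H \<in> insert H0 (\<Union>G\<in>?G. F G)"
    then show "H \<in> {H. subspace H \<and> covers scale U H}"
      using H0 H0U Suc.hyps(2) by (auto simp: F_def covers_def)
  qed
  have disj: "\<forall>G\<in>?G. \<forall>G'\<in>?G. G \<noteq> G' \<longrightarrow> F G \<inter> F G' = {}"
  proof (intro ballI impI)
    fix G G' assume G: "G \<in> ?G" "G' \<in> ?G" "G \<noteq> G'"
    \<comment> \<open>\<open>G\<close> can be recovered from \<open>H\<close>, so no hyperplane is
      counted under two different \<open>G\<close>.\<close>
    have "G = H \<inter> H0" "G' = H \<inter> H0" if "H \<in> F G" "H \<in> F G'" for H
      using that G common_covered_eq(1)[of H H0] H0(1) by (auto simp: F_def)
    with G(3) show "F G \<inter> F G' = {}"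
      by blast
  qed
  \<comment> \<open>In codimension 2 there are \<open>1 + q\<close> covers of \<open>G\<close>
    inside \<open>U\<close>; removing \<open>H0\<close> leaves \<open>q\<close>.\<close>
  have cF: "card (F G) = ?q" if "G \<in> ?G" for G
  proof -
    have "dim U - dim G = 2" "G \<subseteq> U" "subspace G"
      using that H0 Suc.hyps(2) by (auto simp: covers_def)
    moreover have "H0 \<in> {W. subspace W \<and> covers scale W G \<and> W \<subseteq> U}"
      using that H0 by auto
    ultimately show ?thesis
      using card_covers_within[of U G] Suc.prems
      by (simp add: F_def card_Diff_singleton numeral_2_eq_2)
  qed
  have "H0 \<notin> (\<Union>G\<in>?G. F G)"
    by (simp add: F_def)
  then have "card {H. subspace H \<and> covers scale U H} = Suc (card (\<Union>G\<in>?G. F G))"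
    unfolding eq by simp
  also have "card (\<Union>G\<in>?G. F G) = (\<Sum>G\<in>?G. card (F G))"
    using disj by (intro card_UN_disjoint) auto
  also have "\<dots> = card ?G * ?q"
    using cF by simp
  also have "card ?G = (\<Sum>i<n. ?q ^ i)"
    using Suc.hyps(1)[of H0] H0 by simp
  also have "Suc ((\<Sum>i<n. ?q ^ i) * ?q) = (\<Sum>i<Suc n. ?q ^ i)"
    by (simp add: sum.lessThan_Suc_shift sum_distrib_left mult.commute del: sum.lessThan_Suc)
  finally show ?case
    using Suc.hyps(2) by simp
qed

end

section \<open>The matrix relations\<close>

lemmas scaleR_complex = scaleR_conv_of_real[where 'a = complex]

definition diag_mat :: "('x \<Rightarrow> complex) \<Rightarrow> complex ^ 'x ^ 'x" where
  "diag_mat f = (\<chi> y z. if y = z then f y else 0)"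

lemma diag_mat_nth: "diag_mat f $ y $ z = (if y = z then f y else 0)"
  by (simp add: diag_mat_def)

lemma diag_mat_mult_left: "(diag_mat f ** M) $ y $ z = f y * M $ y $ z"
  by (simp add: matrix_matrix_mult_def diag_mat_def if_distrib[of "\<lambda>t. t * _"] cong: if_cong)

lemma diag_mat_mult_right: "(M ** diag_mat f) $ y $ z = M $ y $ z * f z"
  by (simp add: matrix_matrix_mult_def diag_mat_def if_distrib[of "\<lambda>t. _ * t"] cong: if_cong)

text \<open>\<open>matrix_inv\<close> is defined by choice, so a known two-sided inverse first shows
  that the chosen matrix is one too; associativity then identifies the two.\<close>

lemma matrix_inv_unique:
  fixes M :: "'a::semiring_1 ^ 'm ^ 'n"
  assumes "M ** M' = mat 1" "M' ** M = mat 1"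
  shows "matrix_inv M = M'"
proof -
  have "M ** matrix_inv M = mat 1 \<and> matrix_inv M ** M = mat 1"
    unfolding matrix_inv_def by (rule someI[of _ M']) (use assms in simp)
  then show ?thesis
    using assms by (metis matrix_mul_assoc matrix_mul_lid matrix_mul_rid)
qed

lemma matrix_inv_diag_mat:
  assumes "\<And>y. f y \<noteq> 0"
  shows "matrix_inv (diag_mat f) = diag_mat (\<lambda>y. inverse (f y))"
  using assms
  by (intro matrix_inv_unique) (auto simp: vec_eq_iff diag_mat_mult_left diag_mat_nth mat_def)

lemma matrix_mul_distribs:
  fixes A B :: "'a::ring_1 ^ 'n ^ 'm" and C D :: "'a ^ 'p ^ 'n"
  shows "(A + B) ** C = A ** C + B ** C" "(A - B) ** C = A ** C - B ** C"
    "A ** (C + D) = A ** C + A ** D" "A ** (C - D) = A ** C - A ** D"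
  by (simp_all add: vec_eq_iff matrix_matrix_mult_def sum.distrib sum_subtractf algebra_simps)

lemma sum_if_mult_if:
  "(\<Sum>w\<in>(UNIV :: 'x::finite set). (if P w then 1 else 0) * (if Q w then 1 else 0))
    = (of_nat (card {w. P w \<and> Q w}) :: complex)"
proof -
  have "(\<Sum>w\<in>UNIV. (if P w then 1 else 0) * (if Q w then 1 else (0::complex)))
      = (\<Sum>w\<in>UNIV. if P w \<and> Q w then 1 else 0)"
    by (intro sum.cong) auto
  then show ?thesis
    by (simp add: sum.If_cases Int_def)
qed

section \<open>The commutator of lowering and raising\<close>

context finite_field_space
begin

lemma card_index:
  assumes "bij_betw S (UNIV :: 'x::finite set) {U. subspace U}"
  shows "card {w. P (S w)} = card {T. subspace T \<and> P T}"
proof -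
  have "inj_on S {w. P (S w)}"
    using assms by (auto simp: bij_betw_def intro: inj_on_subset)
  moreover have "S ` {w. P (S w)} = {T. subspace T \<and> P T}"
  proof -
    have "subspace T \<longleftrightarrow> T \<in> range S" for T
      using assms by (metis bij_betw_def mem_Collect_eq)
    then show ?thesis
      by auto
  qed
  ultimately show ?thesis
    by (metis card_image)
qed

text \<open>An entry of \<open>L ** R\<close> counts common covers, one of \<open>R ** L\<close>
  counts common covered subspaces. On the diagonal these are all covers and all hyperplanes of
  \<open>S y\<close>, and the factor \<open>q - 1\<close> turns both geometric sums into differences
  of powers.\<close>

lemma L_R_commutator:
  assumes S: "bij_betw S (UNIV :: 'x::finite set) {U. subspace U}"
  shows "(of_nat CARD('k) - 1) *
      (L_mat scale S ** R_mat scale S - R_mat scale S ** L_mat scale S) $ y $ z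
    = (if y = z then of_nat CARD('k) ^ (dim (UNIV :: 'v set) - dim (S y)) - of_nat CARD('k) ^ dim (S y)
       else 0)"
proof -
  have sub: "subspace (S y)" for y
    using S by (auto simp: bij_betw_def)
  have LR: "(L_mat scale S ** R_mat scale S) $ y $ z
      = of_nat (card {T. subspace T \<and> covers scale T (S y) \<and> covers scale T (S z)})" for y z
    by (simp add: matrix_matrix_mult_def L_mat_def R_mat_def sum_if_mult_if card_index[OF S, symmetric])
  have RL: "(R_mat scale S ** L_mat scale S) $ y $ z
      = of_nat (card {T. subspace T \<and> covers scale (S y) T \<and> covers scale (S z) T})" for y z
    by (simp add: matrix_matrix_mult_def L_mat_def R_mat_def sum_if_mult_if card_index[OF S, symmetric])
  show ?thesis
  proof (cases "y = z")
    case True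
    have "(of_nat CARD('k) - 1) * (\<Sum>i<n. of_nat CARD('k) ^ i) = (of_nat CARD('k) ^ n - 1 :: complex)" for n
      by (rule power_diff_1_eq[symmetric])
    then show ?thesis
      using True card_hyperplanes[OF sub[of y]] card_covers_within[OF subspace_UNIV sub[of y]]
      by (simp add: LR RL right_diff_distrib)
  next
    case False
    then have "S y \<noteq> S z"
      using S by (auto simp: bij_betw_def inj_on_def)
    then show ?thesis
      using False card_common_covers[OF sub sub] by (simp add: LR RL)
  qed
qed

section \<open>The decomposition of \<open>A\<close> and the three q-commutation relations\<close>

lemma matrix_relations:
  fixes S :: "'x::finite \<Rightarrow> 'v set" and \<phi> :: real
  defines "q \<equiv> CARD('k)"
  defines "A_star \<equiv> A_star_mat scale S q" and "A_plus \<equiv> A_plus_mat scale S q \<phi>"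
    and "A_minus \<equiv> A_minus_mat scale S q \<phi>"
  assumes S: "bij_betw S UNIV {U. subspace U}" and "\<phi> \<noteq> 0"
  shows "A_mat scale S q \<phi> = \<phi> *\<^sub>R A_plus - A_minus"
    and "real q *\<^sub>R (A_minus ** A_star) - A_star ** A_minus = mat 1"
    and "real q *\<^sub>R (A_star ** A_plus) - A_plus ** A_star = mat 1"
    and "real q *\<^sub>R (A_plus ** A_minus) - A_minus ** A_plus
      = (real q ^ dim (UNIV :: 'v set) / (real q - 1)) *\<^sub>R mat 1"
proof -
  have "q > 1"
    unfolding q_def using card_mono[of UNIV "{0, 1 :: 'k}"] by simp
  define Q where "Q = (of_nat q :: complex)"
  have Q: "Q \<noteq> 0" "Q - 1 \<noteq> 0" "complex_of_nat q = Q"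
    using \<open>q > 1\<close> by (simp_all add: Q_def)
  define f where "f y = Q ^ dim (S y)" for y
  define K where "K = diag_mat f"
  define R where "R = R_mat scale S"
  define L where "L = L_mat scale S"
  have f0: "f y \<noteq> 0" for y
    using Q by (simp add: f_def)
  have A_star: "A_star = diag_mat (\<lambda>y. inverse (f y))"
    by (simp add: vec_eq_iff A_star_def A_star_mat_def diag_mat_nth f_def Q_def power_int_minus)
  then have K: "matrix_inv A_star = K"
    using f0 by (simp add: matrix_inv_diag_mat K_def)
  have A_plus: "A_plus = (1 / (real q - 1)) *\<^sub>R K + inverse \<phi> *\<^sub>R R"
    using K by (simp add: A_plus_def A_plus_mat_def A_star_def R_def)
  have A_minus: "A_minus = (1 / (real q - 1)) *\<^sub>R K - \<phi> *\<^sub>R (K ** L)"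
    using K by (simp add: A_minus_def A_minus_mat_def A_star_def L_def)
  \<comment> \<open>Where \<open>R\<close> or \<open>L\<close> has a nonzero entry, the weights
    \<open>f\<close> of row and column differ by exactly one factor \<open>Q\<close>. Every
    commutation with \<open>K\<close> or its inverse below rests on this.\<close>
  have R: "R $ y $ z = 0 \<or> f y = Q * f z" for y z
    by (auto simp: R_def R_mat_def covers_def f_def)
  have L: "L $ y $ z = 0 \<or> f z = Q * f y" for y z
    by (auto simp: L_def L_mat_def covers_def f_def)
  show "A_mat scale S q \<phi> = \<phi> *\<^sub>R A_plus - A_minus"
  proof -
    have A: "A_mat scale S q \<phi> $ y $ z
        = (of_real \<phi> - 1) / (Q - 1) * K $ y $ z + R $ y $ z + of_real \<phi> * (K ** L) $ y $ z" for y z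
    proof -
      \<comment> \<open>The three cases in \<open>A_mat\<close> exclude each other, so its nested
        conditional is a sum of three matrices.\<close>
      have "\<not> (covers scale (S y) (S z) \<and> covers scale (S z) (S y))" "\<not> covers scale (S y) (S y)"
        by (auto simp: covers_def)
      then show ?thesis
        by (auto simp: A_mat_def K_def diag_mat_mult_left diag_mat_nth R_def R_mat_def L_def L_mat_def
            f_def Q_def)
    qed
    have "A_mat scale S q \<phi> $ y $ z = (\<phi> *\<^sub>R A_plus - A_minus) $ y $ z" for y z
      using \<open>\<phi> \<noteq> 0\<close> Q(2) by (simp add: A A_plus A_minus scaleR_complex Q(3) divide_simps) (simp add: algebra_simps)
    then show ?thesis
      by (simp add: vec_eq_iff)
  qed
  define a where "a = 1 / (real q - 1)"
  define b where "b = complex_of_real a"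
  have b: "b * (Q - 1) = 1"
    using Q(2) by (simp add: b_def a_def Q(3))
  have K_cancel: "K $ y $ z * inverse (f z) = mat 1 $ y $ z" "inverse (f y) * K $ y $ z = mat 1 $ y $ z" for y z
    using f0 by (auto simp: K_def diag_mat_nth mat_def)
  show "real q *\<^sub>R (A_minus ** A_star) - A_star ** A_minus = mat 1"
  proof -
    have "Q * (A_minus $ y $ z * inverse (f z)) - inverse (f y) * A_minus $ y $ z = mat 1 $ y $ z" for y z
    proof -
      have "A_minus $ y $ z = b * K $ y $ z - of_real \<phi> * (f y * L $ y $ z)"
        by (simp add: A_minus K_def diag_mat_mult_left scaleR_complex b_def a_def)
      then have "Q * (A_minus $ y $ z * inverse (f z)) - inverse (f y) * A_minus $ y $ z
          = b * (Q * (K $ y $ z * inverse (f z)) - inverse (f y) * K $ y $ z)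
            - of_real \<phi> * (Q * (f y * L $ y $ z * inverse (f z)) - inverse (f y) * (f y * L $ y $ z))"
        by (simp only:) (simp add: algebra_simps)
      \<comment> \<open>The \<open>L\<close> part cancels by the shift of weights, leaving only the
        diagonal part, which \<open>b\<close> normalises to the identity.\<close>
      also have "Q * (f y * L $ y $ z * inverse (f z)) = inverse (f y) * (f y * L $ y $ z)"
        using L[of y z] f0 Q(1) by auto
      also have "b * (Q * (K $ y $ z * inverse (f z)) - inverse (f y) * K $ y $ z) = b * (Q - 1) * mat 1 $ y $ z"
        by (simp only: K_cancel) (simp add: algebra_simps)
      finally show ?thesis
        by (simp add: b)
    qed
    then show ?thesis
      by (simp add: vec_eq_iff A_star diag_mat_mult_left diag_mat_mult_right scaleR_complex Q(3))
  qed
  show "real q *\<^sub>R (A_star ** A_plus) - A_plus ** A_star = mat 1"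
  proof -
    have "Q * (inverse (f y) * A_plus $ y $ z) - A_plus $ y $ z * inverse (f z) = mat 1 $ y $ z" for y z
    proof -
      have "A_plus $ y $ z = b * K $ y $ z + inverse (of_real \<phi>) * R $ y $ z"
        by (simp add: A_plus scaleR_complex b_def a_def)
      then have "Q * (inverse (f y) * A_plus $ y $ z) - A_plus $ y $ z * inverse (f z)
          = b * (Q * (inverse (f y) * K $ y $ z) - K $ y $ z * inverse (f z))
            + inverse (of_real \<phi>) * (Q * (inverse (f y) * R $ y $ z) - R $ y $ z * inverse (f z))"
        by (simp only:) (simp add: algebra_simps)
      also have "Q * (inverse (f y) * R $ y $ z) = R $ y $ z * inverse (f z)"
        using R[of y z] Q(1) by auto
      also have "b * (Q * (inverse (f y) * K $ y $ z) - K $ y $ z * inverse (f z)) = b * (Q - 1) * mat 1 $ y $ z"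
        by (simp only: K_cancel) (simp add: algebra_simps)
      finally show ?thesis
        by (simp add: b)
    qed
    then show ?thesis
      by (simp add: vec_eq_iff A_star diag_mat_mult_left diag_mat_mult_right scaleR_complex Q(3))
  qed
  have KLK: "(K ** L ** K) $ y $ z = Q * (K ** (K ** L)) $ y $ z" for y z
    using L[of y z] by (auto simp: K_def diag_mat_mult_left diag_mat_mult_right)
  have KR: "(K ** R) $ y $ z = Q * (R ** K) $ y $ z" for y z
    using R[of y z] by (auto simp: K_def diag_mat_mult_left diag_mat_mult_right)
  have KRL: "(K ** (R ** L)) $ y $ z = Q * (R ** (K ** L)) $ y $ z" for y z
  proof -
    \<comment> \<open>The entrywise rule is lifted to a matrix identity so that it can be multiplied
      by \<open>L\<close> on the right.\<close>
    have "K ** R = real q *\<^sub>R (R ** K)"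
      by (simp add: vec_eq_iff KR scaleR_complex Q(3))
    then have "K ** (R ** L) = real q *\<^sub>R (R ** (K ** L))"
      by (simp add: matrix_mul_assoc scalar_matrix_assoc)
    then show ?thesis
      by (simp add: scaleR_complex Q(3))
  qed
  \<comment> \<open>This is the commutator of \<open>L\<close> and \<open>R\<close> multiplied by
    \<open>K\<close> on the left, which turns \<open>q\<^sup>N A\<^sup>* - K\<close> into
    \<open>q\<^sup>N I - K\<^sup>2\<close>.\<close>
  have comm: "(Q - 1) * ((K ** L ** R) $ y $ z - (K ** (R ** L)) $ y $ z)
      = Q ^ dim (UNIV :: 'v set) * mat 1 $ y $ z - (K ** K) $ y $ z" for y z
  proof -
    have "(Q - 1) * ((K ** L ** R) $ y $ z - (K ** (R ** L)) $ y $ z)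
        = f y * ((Q - 1) * (L ** R - R ** L) $ y $ z)"
      by (simp add: K_def diag_mat_mult_left algebra_simps flip: matrix_mul_assoc)
    also have "(Q - 1) * (L ** R - R ** L) $ y $ z
        = (if y = z then Q ^ (dim (UNIV :: 'v set) - dim (S y)) - f y else 0)"
      unfolding L_def R_def Q_def q_def f_def by (rule L_R_commutator[OF S])
    also have "f y * \<dots> = Q ^ dim (UNIV :: 'v set) * mat 1 $ y $ z - (K ** K) $ y $ z"
    proof -
      \<comment> \<open>The truncated subtraction is exact, as \<open>dim (S y)\<close> is at most
        the dimension of the whole space.\<close>
      have "f y * Q ^ (dim (UNIV :: 'v set) - dim (S y)) = Q ^ dim (UNIV :: 'v set)"
        unfolding f_def power_add[symmetric] using dim_subset[of "S y" UNIV]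
        by (intro arg_cong[of _ _ "power Q"] le_add_diff_inverse) simp
      then show ?thesis
        by (auto simp: K_def diag_mat_mult_left diag_mat_nth mat_def right_diff_distrib simp del: dim_UNIV)
    qed
    finally show ?thesis .
  qed
  show "real q *\<^sub>R (A_plus ** A_minus) - A_minus ** A_plus
      = (real q ^ dim (UNIV :: 'v set) / (real q - 1)) *\<^sub>R mat 1"
  proof -
    have pm: "A_plus ** A_minus = a\<^sup>2 *\<^sub>R (K ** K) - (a * \<phi>) *\<^sub>R (K ** (K ** L))
        + (a / \<phi>) *\<^sub>R (R ** K) - R ** (K ** L)"
      unfolding A_plus A_minus a_def[symmetric] using \<open>\<phi> \<noteq> 0\<close>
      by (simp add: matrix_mul_distribs matrix_scalar_ac power2_eq_square divide_inverse algebra_simps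
          flip: scalar_matrix_assoc)
    have mp: "A_minus ** A_plus = a\<^sup>2 *\<^sub>R (K ** K) - (a * \<phi>) *\<^sub>R (K ** L ** K)
        + (a / \<phi>) *\<^sub>R (K ** R) - K ** L ** R"
      unfolding A_plus A_minus a_def[symmetric] using \<open>\<phi> \<noteq> 0\<close>
      by (simp add: matrix_mul_distribs matrix_scalar_ac power2_eq_square divide_inverse algebra_simps
          flip: scalar_matrix_assoc)
    have "Q * (A_plus ** A_minus) $ y $ z - (A_minus ** A_plus) $ y $ z
        = b * Q ^ dim (UNIV :: 'v set) * mat 1 $ y $ z" for y z
    proof -
      \<comment> \<open>By \<open>KLK\<close> and \<open>KR\<close> the terms with a single
        \<open>L\<close> or \<open>R\<close> cancel, and \<open>KRL\<close> brings the mixed terms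
        to the form in \<open>comm\<close>.\<close>
      have "Q * (A_plus ** A_minus) $ y $ z - (A_minus ** A_plus) $ y $ z
          = b * (b * (Q - 1)) * (K ** K) $ y $ z + ((K ** L ** R) $ y $ z - (K ** (R ** L)) $ y $ z)"
        by (simp add: pm mp KLK KR KRL scaleR_complex b_def power2_eq_square algebra_simps)
      \<comment> \<open>Multiplying \<open>comm\<close> by \<open>b\<close> isolates the commutator;
        its \<open>K ** K\<close> term then cancels the one in front.\<close>
      also have "(K ** L ** R) $ y $ z - (K ** (R ** L)) $ y $ z
          = b * (Q ^ dim (UNIV :: 'v set) * mat 1 $ y $ z - (K ** K) $ y $ z)"
        using comm[of y z] b by (metis mult.assoc mult.left_neutral)
      finally show ?thesis
        by (simp only: b) (simp add: algebra_simps)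
    qed
    then show ?thesis
      by (simp add: vec_eq_iff scaleR_complex b_def a_def Q(3))
  qed
qed

end

theorem lemma15p2:
  fixes scl :: "'k::{field,finite} \<Rightarrow> 'v::ab_group_add \<Rightarrow> 'v"
    and B :: "'v set"
    and S :: "'x::finite \<Rightarrow> 'v set"
    and q N :: nat
    and \<phi> :: real
  assumes "primepow q"
    and "CARD('k) = q"
    and "N \<ge> 1"
    and "finite_dimensional_vector_space scl B"
    and "vector_space.dim scl (UNIV :: 'v set) = N"
    and "bij_betw S (UNIV :: 'x set) {U. module.subspace scl U}"
    and "\<phi> > 0"
  shows "let A = A_mat scl S q \<phi>; A_star = A_star_mat scl S q;
             A_plus = A_plus_mat scl S q \<phi>; A_minus = A_minus_mat scl S q \<phi>
         in A = \<phi> *\<^sub>R A_plus - A_minus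
          \<and> real q *\<^sub>R (A_minus ** A_star) - A_star ** A_minus = mat 1
          \<and> real q *\<^sub>R (A_star ** A_plus) - A_plus ** A_star = mat 1
          \<and> real q *\<^sub>R (A_plus ** A_minus) - A_minus ** A_plus
              = (real q ^ N / (real q - 1)) *\<^sub>R mat 1"
proof -
  interpret finite_field_space scl B
    using assms(4) by (simp add: finite_field_space_def)
  show ?thesis
    unfolding Let_def using matrix_relations[OF assms(6), of \<phi>] assms(2,5,7) by auto
qed

end
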